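(* Let $0<q<1$, $\lambda\in\mathbb{R}$, and let $a,b,c,x$ be complex numbers with $a,c,x\neq0$ such that for every integer $m\ge 0$ none of $$aq^{m+1},\ cq^{m+1},\ aq^{\lambda+m+1},\ cq^{\lambda+m+1},\ xq^m,\ \tfrac{b}{c}xq^m,\ \tfrac{x}{a}q^m,\ \tfrac{x}{c}q^m,\ \tfrac{x}{a}q^{m-\lambda},\ \tfrac{x}{c}q^{m-\lambda}$$ equals $1$. Define the fractional Big $q$-Jacobi function by $$P_{\lambda}(x;a,b,c;q)=\frac{a^\lambda c^\lambda q^{\lambda(\lambda+1)}(1-q)^\lambda\left(x,\frac{b}{c}x;q\right)_{\infty}}{(aq,cq;q)_\lambda\left(\frac{x}{a},\frac{x}{c};q\right)_{\infty}}\,D_q^{\lambda}\left[\frac{\left(\frac{x}{aq^{\lambda}},\frac{x}{cq^{\lambda}};q\right)_{\infty}}{\left(x,\frac{b}{c}x;q\right)_{\infty}}\right],$$ where $D_q^\lambda$ acts in the variable $x$. Then $$P_{\lambda}(x;a,b,c;q)=\frac{a^\lambda c^\lambda q^{\lambda(\lambda+1)}x^{-\lambda}}{(aq,cq;q)_\lambda\left(\frac{x}{a},\frac{x}{c};q\right)_{-\lambda}}\;{}_3\phi_2\!\left(\begin{matrix}q^{-\lambda},\,x,\,\frac{b}{c}x\\ \frac{x}{a}q^{-\lambda},\,\frac{x}{c}q^{-\lambda}\end{matrix}\,\middle|\,q;q\right).$$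
   Context: Notation: $(s;q)_n=\prod_{j=0}^{n-1}(1-sq^j)$, $(s;q)_\infty=\prod_{j=0}^\infty(1-sq^j)$, and for any real $\mu$, $(s;q)_\mu=\frac{(s;q)_\infty}{(sq^\mu;q)_\infty}$; $(s_1,\dots,s_r;q)_\mu=\prod_i(s_i;q)_\mu$ for $\mu$ an integer, $\infty$ or real. Powers with real exponent take principal values. The basic hypergeometric series is $${}_3\phi_2\!\left(\begin{matrix}a_1,a_2,a_3\\ b_1,b_2\end{matrix}\,\middle|\,q;z\right)=\sum_{n=0}^\infty\frac{(a_1,a_2,a_3;q)_n}{(b_1,b_2;q)_n}\frac{z^n}{(q;q)_n}.$$ The fractional $q$-derivative of order $\lambda$ is $$(D_q^{\lambda}f)(x)=\frac{1}{x^{\lambda}(1-q)^{\lambda}}\sum_{n=0}^{\infty}\frac{(q^{-\lambda};q)_n}{(q;q)_n}q^n f(q^n x).$$ *)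

theory Defs
  imports "HOL-Analysis.Analysis"
begin

definition qpoch :: "complex \<Rightarrow> real \<Rightarrow> nat \<Rightarrow> complex" where
  "qpoch s q n = (\<Prod>j<n. 1 - s * of_real q ^ j)"

definition qpoch_inf :: "complex \<Rightarrow> real \<Rightarrow> complex" where
  "qpoch_inf s q = (\<Prod>j. 1 - s * of_real q ^ j)"

(* Junk value 0 (division by zero) when the denominator vanishes. *)
definition qpoch_real :: "complex \<Rightarrow> real \<Rightarrow> real \<Rightarrow> complex" where
  "qpoch_real s q \<mu> = qpoch_inf s q / qpoch_inf (s * of_real (q powr \<mu>)) q"

definition phi32 ::
  "complex \<Rightarrow> complex \<Rightarrow> complex \<Rightarrow> complex \<Rightarrow> complex \<Rightarrow> real \<Rightarrow> complex \<Rightarrow> complex" where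
  "phi32 a1 a2 a3 b1 b2 q z =
     (\<Sum>n. (qpoch a1 q n * qpoch a2 q n * qpoch a3 q n) / (qpoch b1 q n * qpoch b2 q n)
            * (z ^ n / qpoch (of_real q) q n))"

(* On complex bases, powr takes the principal value. *)
definition frac_qderiv :: "real \<Rightarrow> real \<Rightarrow> (complex \<Rightarrow> complex) \<Rightarrow> complex \<Rightarrow> complex" where
  "frac_qderiv q lam f x =
     1 / (x powr of_real lam * of_real ((1 - q) powr lam))
     * (\<Sum>n. qpoch (of_real (q powr (-lam))) q n / qpoch (of_real q) q n
              * of_real q ^ n * f (of_real q ^ n * x))"

definition frac_big_q_jacobi ::
  "real \<Rightarrow> complex \<Rightarrow> complex \<Rightarrow> complex \<Rightarrow> complex \<Rightarrow> real \<Rightarrow> complex" where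
  "frac_big_q_jacobi lam x a b c q =
     (a powr of_real lam * c powr of_real lam * of_real (q powr (lam * (lam + 1)))
        * of_real ((1 - q) powr lam) * (qpoch_inf x q * qpoch_inf (b / c * x) q))
     / ((qpoch_real (a * of_real q) q lam * qpoch_real (c * of_real q) q lam)
        * (qpoch_inf (x / a) q * qpoch_inf (x / c) q))
     * frac_qderiv q lam
         (\<lambda>t. (qpoch_inf (t / (a * of_real (q powr lam))) q
               * qpoch_inf (t / (c * of_real (q powr lam))) q)
              / (qpoch_inf t q * qpoch_inf (b / c * t) q)) x"

end

theory Submission
  imports Defs
begin

text \<open>Since \<open>(s q^n; q)\<^sub>\<infinity> = (s; q)\<^sub>\<infinity> / (s; q)\<^sub>n\<close>, evaluating the differentiated function at \<open>q^n x\<close>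
  turns each infinite product into its value at \<open>x\<close> times a finite Pochhammer symbol. The values at
  \<open>x\<close> come out of the sum and cancel the prefactors; what remains is the \<open>3\<phi>2\<close> series.\<close>

text \<open>The factors differ from 1 by the terms of a geometric series with ratio
  \<open>q\<close>, so the product converges absolutely.\<close>

lemma convergent_prod_qpoch:
  assumes "0 < q" "q < 1"
  shows "convergent_prod (\<lambda>j. 1 - s * of_real q ^ j :: complex)"
proof -
  have "summable (\<lambda>j. norm s * q ^ j)"
    using assms by (intro summable_mult summable_geometric) auto
  hence "abs_convergent_prod (\<lambda>j. 1 - s * of_real q ^ j :: complex)"
    using assms by (simp add: abs_convergent_prod_conv_summable norm_mult norm_power)
  thus ?thesis by (rule abs_convergent_prod_imp_convergent_prod)
qed

lemma qpoch_tendsto: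
  assumes "0 < q" "q < 1"
  shows "qpoch s q \<longlonglongrightarrow> qpoch_inf s q"
  using has_prod_imp_tendsto'[OF convergent_prod_has_prod[OF convergent_prod_qpoch[OF assms]]]
  by (simp add: qpoch_def[abs_def] qpoch_inf_def)

lemma qpoch_inf_nonzero:
  assumes "0 < q" "q < 1" "\<And>m. s * of_real q ^ m \<noteq> 1"
  shows "qpoch_inf s q \<noteq> 0"
  unfolding qpoch_inf_def using assms(3)
  by (intro prodinf_nonzero convergent_prod_qpoch assms(1,2)) (metis right_minus_eq)

lemma qpoch_nonzero:
  assumes "\<And>m. s * of_real q ^ m \<noteq> 1"
  shows "qpoch s q n \<noteq> 0"
  unfolding qpoch_def prod_zero_iff[OF finite_lessThan] using assms by (metis right_minus_eq)

lemma qpoch_add: "qpoch s q (n + k) = qpoch s q n * qpoch (s * of_real q ^ n) q k"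
  by (induction k) (simp_all add: qpoch_def power_add mult_ac)

text \<open>Both sides are limits of the same sequence: let \<open>k\<close> tend to infinity in
  \<open>qpoch_add\<close>.\<close>

lemma qpoch_inf_split:
  assumes "0 < q" "q < 1"
  shows "qpoch_inf s q = qpoch s q n * qpoch_inf (s * of_real q ^ n) q"
proof (rule LIMSEQ_unique)
  show "(\<lambda>k. qpoch s q (k + n)) \<longlonglongrightarrow> qpoch_inf s q"
    by (rule LIMSEQ_ignore_initial_segment[OF qpoch_tendsto[OF assms]])
  show "(\<lambda>k. qpoch s q (k + n)) \<longlonglongrightarrow> qpoch s q n * qpoch_inf (s * of_real q ^ n) q"
    unfolding add.commute[of _ n] qpoch_add
    by (intro tendsto_mult tendsto_const qpoch_tendsto assms)
qed

lemma qpoch_inf_shift: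
  assumes "0 < q" "q < 1" "\<And>m. s * of_real q ^ m \<noteq> 1"
  shows "qpoch_inf (s * of_real q ^ n) q = qpoch_inf s q / qpoch s q n"
  using qpoch_inf_split[OF assms(1,2), of s n] qpoch_nonzero[OF assms(3)]
  by (simp add: field_simps)

lemma summable_convergent_mult_geometric:
  fixes r :: "nat \<Rightarrow> complex"
  assumes "r \<longlonglongrightarrow> L" "norm z < 1"
  shows "summable (\<lambda>n. r n * z ^ n)"
proof -
  from assms(1) have "Bseq r" by (intro convergent_imp_Bseq convergentI)
  then obtain K where K: "\<And>n. norm (r n) \<le> K" by (auto simp: Bseq_def)
  have "summable (\<lambda>n. K * norm z ^ n)"
    using assms(2) by (intro summable_mult summable_geometric) auto
  thus ?thesis
    by (rule summable_comparison_test') (auto simp: norm_mult norm_power intro!: mult_right_mono K)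
qed

text \<open>As \<open>n\<close> grows, the coefficient of \<open>z ^ n\<close> tends to a quotient
  of infinite products whose denominator is nonzero, so the series is dominated by a geometric
  one.\<close>

lemma summable_phi32:
  assumes q: "0 < q" "q < 1"
    and z: "norm z < 1"
    and b1: "\<And>m. b1 * of_real q ^ m \<noteq> 1"
    and b2: "\<And>m. b2 * of_real q ^ m \<noteq> 1"
  shows "summable (\<lambda>n. (qpoch a1 q n * qpoch a2 q n * qpoch a3 q n) / (qpoch b1 q n * qpoch b2 q n)
            * (z ^ n / qpoch (of_real q) q n))"
proof -
  \<comment> \<open>This makes the limit \<open>qpoch_inf (of_real q) q\<close> of the third
    denominator factor nonzero.\<close>
  have "of_real q * of_real q ^ m \<noteq> (1 :: complex)" for m
  proof -
    have "q ^ Suc m < 1" using q by (intro power_Suc_less_one) auto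
    hence "complex_of_real (q ^ Suc m) \<noteq> 1" by (metis less_irrefl of_real_eq_1_iff)
    thus ?thesis by simp
  qed
  hence "(\<lambda>n. (qpoch a1 q n * qpoch a2 q n * qpoch a3 q n)
                / (qpoch b1 q n * qpoch b2 q n * qpoch (of_real q) q n))
        \<longlonglongrightarrow> (qpoch_inf a1 q * qpoch_inf a2 q * qpoch_inf a3 q)
                / (qpoch_inf b1 q * qpoch_inf b2 q * qpoch_inf (of_real q) q)"
    using q b1 b2 by (intro tendsto_intros qpoch_tendsto) (simp_all add: qpoch_inf_nonzero)
  from summable_convergent_mult_geometric[OF this z] show ?thesis by simp
qed

theorem proposition7:
  fixes q lam :: real and a b c x :: complex
  assumes "0 < q" and "q < 1"
    and "a \<noteq> 0" and "c \<noteq> 0" and "x \<noteq> 0"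
    and "\<And>m::nat. a * of_real q ^ (m + 1) \<noteq> 1"
    and "\<And>m::nat. c * of_real q ^ (m + 1) \<noteq> 1"
    and "\<And>m::nat. a * of_real (q powr (lam + real m + 1)) \<noteq> 1"
    and "\<And>m::nat. c * of_real (q powr (lam + real m + 1)) \<noteq> 1"
    and "\<And>m::nat. x * of_real q ^ m \<noteq> 1"
    and "\<And>m::nat. b / c * x * of_real q ^ m \<noteq> 1"
    and "\<And>m::nat. x / a * of_real q ^ m \<noteq> 1"
    and "\<And>m::nat. x / c * of_real q ^ m \<noteq> 1"
    and "\<And>m::nat. x / a * of_real (q powr (real m - lam)) \<noteq> 1"
    and "\<And>m::nat. x / c * of_real (q powr (real m - lam)) \<noteq> 1"
  shows "frac_big_q_jacobi lam x a b c q =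
    (a powr of_real lam * c powr of_real lam * of_real (q powr (lam * (lam + 1)))
       * x powr of_real (-lam))
    / ((qpoch_real (a * of_real q) q lam * qpoch_real (c * of_real q) q lam)
       * (qpoch_real (x / a) q (-lam) * qpoch_real (x / c) q (-lam)))
    * phi32 (of_real (q powr (-lam))) x (b / c * x)
        (x / a * of_real (q powr (-lam))) (x / c * of_real (q powr (-lam))) q (of_real q)"
proof -
  note q = assms(1,2)
  \<comment> \<open>\<open>A\<close> and \<open>B\<close> are the lower parameters of the series and
    also the arguments of the two numerator products of the differentiated function at
    \<open>x\<close>.\<close>
  define A where "A = x / a * of_real (q powr (-lam))"
  define B where "B = x / c * of_real (q powr (-lam))"
  define Q :: complex where "Q = of_real (q powr (-lam))"
  \<comment> \<open>Brings the hypotheses with exponent \<open>real m - lam\<close> into the form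
    that the Pochhammer lemmas expect.\<close>
  have shift: "s * of_real (q powr (-lam)) * of_real q ^ m = s * of_real (q powr (real m - lam))"
    for s :: complex and m
    using q by (simp add: powr_diff powr_minus powr_realpow field_simps)
  have A: "A * of_real q ^ m \<noteq> 1" and B: "B * of_real q ^ m \<noteq> 1" for m
    unfolding A_def B_def shift by (rule assms)+
  have argA: "of_real q ^ n * x / (a * of_real (q powr lam)) = A * of_real q ^ n"
    and argB: "of_real q ^ n * x / (c * of_real (q powr lam)) = B * of_real q ^ n" for n
    unfolding A_def B_def by (simp_all add: powr_minus field_simps)
  \<comment> \<open>\<open>K\<close> is the differentiated function at \<open>x\<close>, and
    \<open>T\<close> is the sequence of terms of the target series.\<close>
  define K where "K = qpoch_inf A q * qpoch_inf B q / (qpoch_inf x q * qpoch_inf (b / c * x) q)"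
  define T where "T = (\<lambda>n. (qpoch Q q n * qpoch x q n * qpoch (b / c * x) q n)
       / (qpoch A q n * qpoch B q n) * (of_real q ^ n / qpoch (of_real q) q n))"
  \<comment> \<open>Needed to pull the constant \<open>K\<close> out of the infinite sum.\<close>
  have "summable T"
    unfolding T_def using q A B by (intro summable_phi32) auto
  have shift_x: "qpoch_inf (of_real q ^ n * x) q = qpoch_inf x q / qpoch x q n"
    and shift_bx: "qpoch_inf (b / c * (of_real q ^ n * x)) q = qpoch_inf (b / c * x) q / qpoch (b / c * x) q n"
    for n
    using qpoch_inf_shift[OF q assms(10), of n] qpoch_inf_shift[OF q assms(11), of n]
    by (simp_all add: mult_ac)
  \<comment> \<open>Each shift divides by a finite symbol, so the numerator products yield the lower
    parameters \<open>A\<close>, \<open>B\<close> and the denominator products the upper parameters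
    \<open>x\<close>, \<open>b / c * x\<close>.\<close>
  have "qpoch Q q n / qpoch (of_real q) q n * of_real q ^ n *
      (qpoch_inf (of_real q ^ n * x / (a * of_real (q powr lam))) q
        * qpoch_inf (of_real q ^ n * x / (c * of_real (q powr lam))) q
        / (qpoch_inf (of_real q ^ n * x) q * qpoch_inf (b / c * (of_real q ^ n * x)) q))
      = K * T n" for n
    unfolding argA argB shift_x shift_bx qpoch_inf_shift[OF q A] qpoch_inf_shift[OF q B] K_def T_def
    by (simp add: mult_ac)
  hence deriv: "frac_qderiv q lam
         (\<lambda>t. (qpoch_inf (t / (a * of_real (q powr lam))) q
               * qpoch_inf (t / (c * of_real (q powr lam))) q)
              / (qpoch_inf t q * qpoch_inf (b / c * t) q)) x
      = 1 / (x powr of_real lam * of_real ((1 - q) powr lam)) * (K * suminf T)"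
    unfolding frac_qderiv_def Q_def[symmetric] by (simp add: suminf_mult[OF \<open>summable T\<close>])
  have phi: "phi32 Q x (b / c * x) A B q (of_real q) = suminf T"
    by (simp add: phi32_def T_def)
  have "qpoch_inf x q \<noteq> 0" "qpoch_inf (b / c * x) q \<noteq> 0"
    by (rule qpoch_inf_nonzero[OF q]; rule assms)+
  moreover have "complex_of_real ((1 - q) powr lam) \<noteq> 0" using q by simp
  ultimately show ?thesis
    unfolding frac_big_q_jacobi_def deriv
    \<comment> \<open>Only the symbols of order \<open>-lam\<close> are expanded: they supply the
      products at \<open>A\<close> and \<open>B\<close> that match the numerator of
      \<open>K\<close>. Those of order \<open>lam\<close> occur identically on both sides.\<close>
    unfolding qpoch_real_def[of "x / a"] qpoch_real_def[of "x / c"]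
    \<comment> \<open>\<open>A\<close> and \<open>B\<close> are folded before \<open>Q\<close>,
      because their definitions contain the expression that \<open>Q\<close> abbreviates.\<close>
    unfolding A_def[symmetric] B_def[symmetric]
    unfolding Q_def[symmetric] phi
    unfolding K_def of_real_minus powr_minus
    by (simp add: divide_simps)
qed

end
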